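(* Let $0\le\alpha<\frac{\pi}{2}$, let $A,B\in\mathcal{S}_\alpha$ be accretive $n\times n$ complex matrices, and let $f:(0,\infty)\to(0,\infty)$ be an operator monotone function with $f(1)=1$. Then $$w(A\,\sigma_f\,B)\le\sec^3\alpha\,\bigl(w(A)\,\sigma_f\,w(B)\bigr).$$
   Context: $\mathcal{M}_n$ is the algebra of complex $n\times n$ matrices. For $A\in\mathcal{M}_n$: $w(A)=\max\{|\langle Ax,x\rangle|:x\in\mathbb{C}^n,\|x\|=1\}$ is the numerical radius and $W(A)=\{\langle Ax,x\rangle:x\in\mathbb{C}^n,\|x\|=1\}$ is the numerical range. $A$ is accretive if $\Re A=\frac{A+A^*}{2}$ is positive definite. For $0\le\alpha<\pi/2$ let $S_\alpha=\{z\in\mathbb{C}:|\Im z|\le\tan\alpha\,\Re z\}$; we write $A\in\mathcal{S}_\alpha$ if $W(A)\subset S_\alpha$. A function $f:(0,\infty)\to(0,\infty)$ is operator monotone if $X\le Y$ implies $f(X)\le f(Y)$ for all positive definite matrices $X,Y$ of any size. If moreover $f(1)=1$, there is a probability measure $\nu_f$ on $[0,1]$ with $f(x)=\int_0^1((1-s)+sx^{-1})^{-1}d\nu_f(s)$ for $x>0$. For accretive $A,B$ the operator mean is $A\,\sigma_f\,B=\int_0^1(A\,!_s\,B)\,d\nu_f(s)$, where $A\,!_s\,B=((1-s)A^{-1}+sB^{-1})^{-1}$. For positive scalars $a,b$, the mean $a\,\sigma_f\,b$ is given by the same formula (the $1\times1$ case). *)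

theory Defs
  imports
    "HOL-Probability.Probability"
    "Jordan_Normal_Form.Schur_Decomposition"
    "Jordan_Normal_Form.Gauss_Jordan_Elimination"
begin

text \<open>
  Matrices are those of the type \<^typ>\<open>complex mat\<close>, whose size is a natural number, because operator
  monotonicity quantifies over all matrix sizes. The inner product
  $\langle v, w\rangle$, linear in the first argument, is \<^term>\<open>v \<bullet>c w\<close>, and the conjugate
  transpose is \<^const>\<open>mat_adjoint\<close>.
\<close>

definition unit_vectors :: "nat \<Rightarrow> complex vec set" where
  "unit_vectors n = {x \<in> carrier_vec n. sqrt (Re (x \<bullet>c x)) = 1}"

definition numerical_range :: "complex mat \<Rightarrow> complex set" where
  "numerical_range A = {(A *\<^sub>v x) \<bullet>c x | x. x \<in> unit_vectors (dim_row A)}"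

text \<open>
  For square matrices of positive size the supremum is a maximum; see
  \<open>numerical_radius_attained\<close> and \<open>numerical_radius_upper\<close> below.
\<close>

definition numerical_radius :: "complex mat \<Rightarrow> real" where
  "numerical_radius A = (SUP x\<in>unit_vectors (dim_row A). cmod ((A *\<^sub>v x) \<bullet>c x))"

definition sector :: "real \<Rightarrow> complex set" where
  "sector \<alpha> = {z. \<bar>Im z\<bar> \<le> tan \<alpha> * Re z}"

definition sectorial :: "real \<Rightarrow> complex mat \<Rightarrow> bool" where
  "sectorial \<alpha> A \<longleftrightarrow> numerical_range A \<subseteq> sector \<alpha>"

definition hermitian_mat :: "complex mat \<Rightarrow> bool" where
  "hermitian_mat X \<longleftrightarrow> square_mat X \<and> mat_adjoint X = X"

definition pos_definite :: "complex mat \<Rightarrow> bool" where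
  "pos_definite X \<longleftrightarrow> hermitian_mat X \<and>
     (\<forall>v\<in>carrier_vec (dim_row X). v \<noteq> 0\<^sub>v (dim_row X) \<longrightarrow> 0 < Re ((X *\<^sub>v v) \<bullet>c v))"

definition pos_semidefinite :: "complex mat \<Rightarrow> bool" where
  "pos_semidefinite X \<longleftrightarrow> hermitian_mat X \<and>
     (\<forall>v\<in>carrier_vec (dim_row X). 0 \<le> Re ((X *\<^sub>v v) \<bullet>c v))"

definition loewner_le :: "complex mat \<Rightarrow> complex mat \<Rightarrow> bool" where
  "loewner_le X Y \<longleftrightarrow> pos_semidefinite (Y - X)"

definition real_part_mat :: "complex mat \<Rightarrow> complex mat" where
  "real_part_mat A = (1 / 2) \<cdot>\<^sub>m (A + mat_adjoint A)"

definition accretive :: "complex mat \<Rightarrow> bool" where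
  "accretive A \<longleftrightarrow> pos_definite (real_part_mat A)"

definition unitary_mat :: "complex mat \<Rightarrow> bool" where
  "unitary_mat U \<longleftrightarrow> square_mat U \<and> mat_adjoint U * U = 1\<^sub>m (dim_row U)
     \<and> U * mat_adjoint U = 1\<^sub>m (dim_row U)"

text \<open>
  Functional calculus: $f(U\,\mathrm{diag}(d)\,U^*) = U\,\mathrm{diag}(f(d))\,U^*$ for unitary $U$
  and real $d$. The result does not depend on the chosen diagonalization; see
  \<open>mat_fun_diagonalization\<close> below.
\<close>

definition diagonalizes :: "complex mat \<Rightarrow> (nat \<Rightarrow> real) \<Rightarrow> complex mat \<Rightarrow> bool" where
  "diagonalizes U d X \<longleftrightarrow> unitary_mat U \<and>
     X = U * mat_diag (dim_row U) (\<lambda>i. complex_of_real (d i)) * mat_adjoint U"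

definition mat_fun :: "(real \<Rightarrow> real) \<Rightarrow> complex mat \<Rightarrow> complex mat" where
  "mat_fun f X = (THE Y. \<exists>U d. diagonalizes U d X \<and> diagonalizes U (\<lambda>i. f (d i)) Y)"

definition operator_monotone :: "(real \<Rightarrow> real) \<Rightarrow> bool" where
  "operator_monotone f \<longleftrightarrow>
     (\<forall>n. \<forall>X\<in>carrier_mat n n. \<forall>Y\<in>carrier_mat n n.
        pos_definite X \<longrightarrow> pos_definite Y \<longrightarrow> loewner_le X Y \<longrightarrow>
        loewner_le (mat_fun f X) (mat_fun f Y))"

definition mat_inv :: "complex mat \<Rightarrow> complex mat" where
  "mat_inv A = the (mat_inverse A)"

definition harmonic_mean_mat :: "real \<Rightarrow> complex mat \<Rightarrow> complex mat \<Rightarrow> complex mat" where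
  "harmonic_mean_mat s A B =
     mat_inv (complex_of_real (1 - s) \<cdot>\<^sub>m mat_inv A + complex_of_real s \<cdot>\<^sub>m mat_inv B)"

text \<open>
  \<open>representing_measure f \<nu>\<close>: \<open>\<nu>\<close> is a Borel probability measure on $[0,1]$ with
  $f(x) = \int_0^1 ((1-s) + s x^{-1})^{-1}\,d\nu(s)$ for all $x > 0$, that is, $\nu = \nu_f$.
\<close>

definition representing_measure :: "(real \<Rightarrow> real) \<Rightarrow> real measure \<Rightarrow> bool" where
  "representing_measure f \<nu> \<longleftrightarrow>
     prob_space \<nu> \<and> sets \<nu> = sets (restrict_space borel {0..1}) \<and>
     (\<forall>x>0. f x = (LINT s|\<nu>. inverse ((1 - s) + s * inverse x)))"

text \<open>The operator mean and its scalar version; the integral of matrices is taken entrywise.\<close>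

definition operator_mean :: "real measure \<Rightarrow> complex mat \<Rightarrow> complex mat \<Rightarrow> complex mat" where
  "operator_mean \<nu> A B =
     Matrix.mat (dim_row A) (dim_col A) (\<lambda>(i, j). LINT s|\<nu>. harmonic_mean_mat s A B $$ (i, j))"

definition scalar_mean :: "real measure \<Rightarrow> real \<Rightarrow> real \<Rightarrow> real" where
  "scalar_mean \<nu> a b = (LINT s|\<nu>. inverse ((1 - s) * inverse a + s * inverse b))"


lemma mat_adjoint_carrier [simp]: "U \<in> carrier_mat n m \<Longrightarrow> mat_adjoint U \<in> carrier_mat m n"
  unfolding mat_adjoint_def by auto

lemma mat_fun_diagonalization:
  assumes X: "diagonalizes U d X"
  shows "diagonalizes U (\<lambda>i. f (d i)) (mat_fun f X)"
proof -
  let ?D = "\<lambda>n (d :: nat \<Rightarrow> real). mat_diag n (\<lambda>i. complex_of_real (d i))"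
  let ?Y = "U * ?D (dim_row U) (\<lambda>i. f (d i)) * mat_adjoint U"
  have Y: "diagonalizes U (\<lambda>i. f (d i)) ?Y"
    using X unfolding diagonalizes_def by auto
  have "Z = ?Y" if Z: "diagonalizes V e X" "diagonalizes V (\<lambda>i. f (e i)) Z" for Z V e
  proof -
    define n where "n = dim_row U"
    have U: "U \<in> carrier_mat n n" and UU: "mat_adjoint U * U = 1\<^sub>m n" "U * mat_adjoint U = 1\<^sub>m n"
      using X unfolding diagonalizes_def unitary_mat_def n_def by auto
    have XU: "X = U * ?D n d * mat_adjoint U"
      using X unfolding diagonalizes_def n_def by auto
    have "dim_row X = dim_row V" using Z unfolding diagonalizes_def by auto
    moreover have "dim_row X = n" using XU U by auto
    ultimately have nV: "dim_row V = n" by simp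
    have V: "V \<in> carrier_mat n n" and VV: "mat_adjoint V * V = 1\<^sub>m n" "V * mat_adjoint V = 1\<^sub>m n"
      using Z nV unfolding diagonalizes_def unitary_mat_def by auto
    have XV: "X = V * ?D n e * mat_adjoint V" and ZV: "Z = V * ?D n (\<lambda>i. f (e i)) * mat_adjoint V"
      using Z nV unfolding diagonalizes_def by auto
    define U' where "U' = mat_adjoint U"
    define V' where "V' = mat_adjoint V"
    have U': "U' \<in> carrier_mat n n" and V': "V' \<in> carrier_mat n n"
      using U V unfolding U'_def V'_def by auto
    have D: "?D n g \<in> carrier_mat n n" for g by simp
    have mc: "P * Q \<in> carrier_mat n n"
      if "P \<in> carrier_mat n n" "Q \<in> carrier_mat n n" for P Q :: "complex mat"
      using that by (rule mult_carrier_mat)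
    define W where "W = V' * U"
    have W: "W \<in> carrier_mat n n" unfolding W_def using V' U by simp
    have am: "P * Q * R = P * (Q * R)"
      if "P \<in> carrier_mat n n" "Q \<in> carrier_mat n n" "R \<in> carrier_mat n n"
      for P Q R :: "complex mat"
      using that by (rule assoc_mult_mat)
    note UU' = UU[folded U'_def] and VV' = VV[folded V'_def]
    have Xc: "X \<in> carrier_mat n n" unfolding XU U'_def[symmetric] by (intro mc U U' D)
    have Zc: "Z \<in> carrier_mat n n" unfolding ZV V'_def[symmetric] by (intro mc V V' D)
    have "X * U = U * ?D n d * (U' * U)"
      unfolding XU U'_def[symmetric] by (intro am mc U U' D)
    hence XU2: "X * U = U * ?D n d"
      unfolding UU' by (simp only: right_mult_one_mat[OF mc[OF U D]])
    have "V' * X = V' * (V * (?D n e * V'))"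
      unfolding XV V'_def[symmetric] by (simp only: am[OF V D V'])
    also have "\<dots> = (V' * V) * (?D n e * V')" by (intro am[symmetric] mc V V' D)
    finally have VX: "V' * X = ?D n e * V'"
      unfolding VV' by (simp only: left_mult_one_mat[OF mc[OF D V']])
    have inter: "W * ?D n d = ?D n e * W"
    proof -
      have "W * ?D n d = V' * (X * U)" unfolding W_def XU2 by (intro am V' U D)
      also have "\<dots> = (V' * X) * U" by (intro am[symmetric] V' U Xc)
      also have "\<dots> = ?D n e * W" unfolding VX W_def by (intro am V' U D)
      finally show ?thesis .
    qed
    have interf: "W * ?D n (\<lambda>i. f (d i)) = ?D n (\<lambda>i. f (e i)) * W"
    proof (rule eq_matI)
      fix i j assume "i < dim_row (?D n (\<lambda>i. f (e i)) * W)" "j < dim_col (?D n (\<lambda>i. f (e i)) * W)"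
      hence ij: "i < n" "j < n" using W by (auto simp: mat_diag_def)
      have "(W * ?D n d) $$ (i, j) = (?D n e * W) $$ (i, j)" using inter by simp
      hence "W $$ (i, j) * d j = e i * W $$ (i, j)"
        using ij by (simp add: mat_diag_mult_left[OF W] mat_diag_mult_right[OF W])
      hence "W $$ (i, j) = 0 \<or> d j = e i" by auto
      thus "(W * ?D n (\<lambda>i. f (d i))) $$ (i, j) = (?D n (\<lambda>i. f (e i)) * W) $$ (i, j)"
        using ij by (auto simp: mat_diag_mult_left[OF W] mat_diag_mult_right[OF W])
    qed (use W in \<open>auto simp: mat_diag_def\<close>)
    let ?F = "?D n (\<lambda>i. f (d i))" and ?E = "?D n (\<lambda>i. f (e i))"
    have "Z * U = V * ?E * W"
      unfolding ZV V'_def[symmetric] W_def by (intro am mc V V' U D)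
    also have "\<dots> = V * (?E * W)" by (intro am V W D)
    also have "\<dots> = V * (W * ?F)" unfolding interf ..
    also have "\<dots> = V * W * ?F" by (intro am[symmetric] V W D)
    also have "V * W = (V * V') * U" unfolding W_def by (intro am[symmetric] V V' U)
    also have "\<dots> = U" unfolding VV' by (rule left_mult_one_mat[OF U])
    finally have ZU: "Z * U = U * ?F" .
    have "Z = Z * (U * U')" unfolding UU' by (simp only: right_mult_one_mat[OF Zc])
    also have "\<dots> = Z * U * U'" by (intro am[symmetric] Zc U U')
    also have "\<dots> = U * ?F * U'" unfolding ZU ..
    finally show ?thesis unfolding U'_def n_def .
  qed
  hence "mat_fun f X = ?Y"
    unfolding mat_fun_def using X Y by (intro the_equality) blast+
  thus ?thesis using Y by simp
qed

lemma numerical_radius_max: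
  assumes A: "A \<in> carrier_mat n n" and n: "0 < n"
  shows "\<exists>x\<in>unit_vectors n. \<forall>y\<in>unit_vectors n.
           cmod ((A *\<^sub>v y) \<bullet>c y) \<le> cmod ((A *\<^sub>v x) \<bullet>c x)"
proof -
  define S where "S = (PiE UNIV (\<lambda>i. if i < n then cball 0 1 else {0 :: complex}))
                       \<inter> {x :: nat \<Rightarrow> complex. (\<Sum>i<n. (cmod (x i))\<^sup>2) = 1}"
  define g where "g = (\<lambda>x :: nat \<Rightarrow> complex. cmod (\<Sum>i<n. (\<Sum>j<n. A $$ (i, j) * x j) * cnj (x i)))"
  have cont: "continuous_on T (\<lambda>x :: nat \<Rightarrow> complex. x i)" for i T
    by (rule continuous_on_subset[OF continuous_on_product_coordinates]) simp
  have "compactin (product_topology (\<lambda>_. euclidean) UNIV)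
          (PiE UNIV (\<lambda>i. if i < n then cball 0 1 else {0 :: complex}))"
    unfolding compactin_PiE by auto
  hence "compact (PiE UNIV (\<lambda>i. if i < n then cball 0 1 else {0 :: complex}))"
    by (simp add: euclidean_product_topology)
  moreover have "closed {x :: nat \<Rightarrow> complex. (\<Sum>i<n. (cmod (x i))\<^sup>2) = 1}"
    by (intro closed_Collect_eq continuous_intros cont)
  ultimately have cS: "compact S" unfolding S_def by (rule compact_Int_closed)
  have "(\<lambda>i. if i = 0 then 1 else 0) \<in> S"
  proof -
    have "(\<Sum>i<n. (cmod (if i = 0 then 1 else 0))\<^sup>2) = (\<Sum>i<n. if i = 0 then 1 else 0 :: real)"
      by (rule sum.cong) auto
    thus ?thesis using n unfolding S_def by auto
  qed
  hence "S \<noteq> {}" by blast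
  moreover have "continuous_on S g" unfolding g_def by (intro continuous_intros cont)
  ultimately obtain m where m: "m \<in> S" "\<forall>y\<in>S. g y \<le> g m"
    using continuous_attains_sup[OF cS] by blast
  have nrm: "Re (x \<bullet>c x) = (\<Sum>i<n. (cmod (x $ i))\<^sup>2)" if "x \<in> carrier_vec n" for x :: "complex vec"
  proof -
    have "x \<bullet>c x = (\<Sum>i<n. x $ i * cnj (x $ i))"
      using that by (simp add: scalar_prod_def lessThan_atLeast0)
    also have "\<dots> = (\<Sum>i<n. complex_of_real ((cmod (x $ i))\<^sup>2))"
      by (intro sum.cong refl) (simp only: complex_norm_square)
    finally show ?thesis by (simp only: Re_sum Re_complex_of_real)
  qed
  have gx: "cmod ((A *\<^sub>v x) \<bullet>c x) = g (\<lambda>i. if i < n then x $ i else 0)" if "x \<in> carrier_vec n" for x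
    using that A unfolding g_def
    by (auto simp: scalar_prod_def lessThan_atLeast0 intro!: arg_cong[where f = cmod] sum.cong)
  have inS: "(\<lambda>i. if i < n then x $ i else 0) \<in> S" if x: "x \<in> unit_vectors n" for x
  proof -
    have s: "(\<Sum>i<n. (cmod (x $ i))\<^sup>2) = 1"
      using x nrm unfolding unit_vectors_def by (auto simp: real_sqrt_eq_1_iff)
    have "cmod (x $ i) \<le> 1" if "i < n" for i
    proof -
      have "(cmod (x $ i))\<^sup>2 \<le> (\<Sum>i<n. (cmod (x $ i))\<^sup>2)"
        using that by (intro member_le_sum) auto
      hence "(cmod (x $ i))\<^sup>2 \<le> 1\<^sup>2" using s by simp
      thus ?thesis by (rule power2_le_imp_le) simp
    qed
    thus ?thesis using s unfolding S_def by auto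
  qed
  define x where "x = Matrix.vec n m"
  have xc: "x \<in> carrier_vec n" unfolding x_def by simp
  have mx: "(\<lambda>i. if i < n then x $ i else 0) = m"
  proof
    fix i
    have "m i \<in> (if i < n then cball 0 1 else {0 :: complex})"
      using m(1) unfolding S_def by (blast dest: PiE_mem)
    thus "(if i < n then x $ i else 0) = m i"
      unfolding x_def by (auto split: if_splits)
  qed
  have "(\<Sum>i<n. (cmod (x $ i))\<^sup>2) = (\<Sum>i<n. (cmod (m i))\<^sup>2)" unfolding x_def by simp
  hence "x \<in> unit_vectors n"
    using m(1) nrm[OF xc] xc unfolding S_def unit_vectors_def by simp
  moreover have "cmod ((A *\<^sub>v y) \<bullet>c y) \<le> cmod ((A *\<^sub>v x) \<bullet>c x)" if "y \<in> unit_vectors n" for y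
    using m(2) inS[OF that] gx[OF xc] gx[of y] that mx unfolding unit_vectors_def by auto
  ultimately show ?thesis by blast
qed

lemma numerical_radius_attained:
  assumes A: "A \<in> carrier_mat n n" and n: "0 < n"
  shows "\<exists>x\<in>unit_vectors n. numerical_radius A = cmod ((A *\<^sub>v x) \<bullet>c x)"
proof -
  obtain x where x: "x \<in> unit_vectors n"
    "\<forall>y\<in>unit_vectors n. cmod ((A *\<^sub>v y) \<bullet>c y) \<le> cmod ((A *\<^sub>v x) \<bullet>c x)"
    using numerical_radius_max[OF A n] by blast
  have "numerical_radius A = cmod ((A *\<^sub>v x) \<bullet>c x)"
    unfolding numerical_radius_def using A x by (intro cSup_eq_maximum) auto
  thus ?thesis using x by blast
qed

lemma numerical_radius_upper:
  assumes A: "A \<in> carrier_mat n n" and x: "x \<in> unit_vectors n"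
  shows "cmod ((A *\<^sub>v x) \<bullet>c x) \<le> numerical_radius A"
proof -
  have n: "0 < n"
    using x by (cases n) (auto simp: unit_vectors_def scalar_prod_def)
  have "bdd_above ((\<lambda>x. cmod ((A *\<^sub>v x) \<bullet>c x)) ` unit_vectors n)"
    using numerical_radius_max[OF A n] by (auto intro: bdd_aboveI2)
  thus ?thesis
    unfolding numerical_radius_def using A x by (intro cSup_upper) auto
qed

end

theory Submission
  imports Defs
begin

text \<open>
  The integrand is estimated pointwise in \<open>s\<close>. If \<open>x\<close> is a unit vector and
  \<open>y = (A !\<^sub>s B) x\<close>, then $x = ((1-s)A^{-1} + sB^{-1})y$. A Cauchy-Schwarz inequality for sectorial
  forms, $|\langle Au, z\rangle|^2 \le \sec^2\alpha\, \Re\langle Au, u\rangle\, \Re\langle Az, z\rangle$,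
  applied to $z = Au = y$, gives $\Re\langle A^{-1}y, y\rangle \ge \cos^2\alpha\, \|y\|^2 / w(A)$, and
  likewise for \<open>B\<close>. Hence $\Re\langle x, y\rangle \ge c \|y\|^2$ with
  $c = \cos^2\alpha\, ((1-s)/w(A) + s/w(B))$, while $|\langle x, y\rangle| \le \|y\|$; together
  $|\langle x, y\rangle| \le 1/c$. This already yields the inequality with the constant
  $\sec^2\alpha \le \sec^3\alpha$.
\<close>

section \<open>Inner product and Cauchy-Schwarz for semidefinite forms\<close>

lemma cscalar_prod_commute:
  fixes v w :: "complex vec"
  assumes "v \<in> carrier_vec n" "w \<in> carrier_vec n"
  shows "w \<bullet>c v = cnj (v \<bullet>c w)"
  using assms by (auto simp: scalar_prod_def mult.commute intro!: sum.cong)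

lemma Re_cscalar_prod_self_nonneg: "0 \<le> Re (v \<bullet>c v)"
  using conjugate_square_ge_0_vec[of v] by (simp add: less_eq_complex_def)

lemma Re_cscalar_prod_self_pos:
  assumes "v \<in> carrier_vec n" "v \<noteq> 0\<^sub>v n"
  shows "0 < Re (v \<bullet>c v)"
  using conjugate_square_greater_0_vec[OF assms(1)] assms(2) by (simp add: less_complex_def)

text \<open>The form is abstract so that the result covers the inner product as well as the
  Hermitian forms attached to a sectorial matrix. The latter may be degenerate, so
  \<open>h z z = 0\<close> does not force \<open>z = 0\<close> and needs its own argument.\<close>

lemma semidefinite_form_Cauchy_Schwarz:
  fixes h :: "complex vec \<Rightarrow> complex vec \<Rightarrow> complex"
  assumes add: "\<And>u v w. \<lbrakk>u \<in> carrier_vec n; v \<in> carrier_vec n; w \<in> carrier_vec n\<rbrakk>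
      \<Longrightarrow> h (u + v) w = h u w + h v w"
    and smult: "\<And>k u w. \<lbrakk>u \<in> carrier_vec n; w \<in> carrier_vec n\<rbrakk> \<Longrightarrow> h (k \<cdot>\<^sub>v u) w = k * h u w"
    and herm: "\<And>u w. \<lbrakk>u \<in> carrier_vec n; w \<in> carrier_vec n\<rbrakk> \<Longrightarrow> h w u = cnj (h u w)"
    and pos: "\<And>u. u \<in> carrier_vec n \<Longrightarrow> 0 \<le> Re (h u u)"
    and u: "u \<in> carrier_vec n" and z: "z \<in> carrier_vec n"
  shows "(cmod (h u z))\<^sup>2 \<le> Re (h u u) * Re (h z z)"
proof -
  define w a b where "w = (cmod (h u z))\<^sup>2" and "a = Re (h u u)" and "b = Re (h z z)"
  have quad: "0 \<le> a - 2 * t * w + t\<^sup>2 * w * b" for t :: real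
  proof -
    \<comment> \<open>The factor \<open>h u z\<close> aligns the phases: the cross terms of the form
      at \<open>u + k z\<close> become real and add up to \<open>- 2 * t * w\<close>.\<close>
    define k where "k = - of_real t * h u z"
    have kz: "k \<cdot>\<^sub>v z \<in> carrier_vec n" using z by simp
    have "h (u + k \<cdot>\<^sub>v z) (u + k \<cdot>\<^sub>v z) = h u (u + k \<cdot>\<^sub>v z) + k * h z (u + k \<cdot>\<^sub>v z)"
      using u z kz by (simp add: add smult)
    also have "h u (u + k \<cdot>\<^sub>v z) = cnj (h u u + k * h z u)"
      using u z kz by (subst herm) (simp_all add: add smult)
    also have "h z (u + k \<cdot>\<^sub>v z) = cnj (h u z + k * h z z)"
      using u z kz by (subst herm) (simp_all add: add smult)
    also have "h z u = cnj (h u z)" using u z by (rule herm)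
    finally have eq: "h (u + k \<cdot>\<^sub>v z) (u + k \<cdot>\<^sub>v z)
        = cnj (h u u + k * cnj (h u z)) + k * cnj (h u z + k * h z z)" .
    have "Re (h (u + k \<cdot>\<^sub>v z) (u + k \<cdot>\<^sub>v z)) = a - 2 * t * w + t\<^sup>2 * w * b"
      unfolding eq unfolding k_def w_def a_def b_def cmod_power2
      by (simp add: power2_eq_square algebra_simps)
    thus ?thesis using pos[of "u + k \<cdot>\<^sub>v z"] u kz by simp
  qed
  have a: "0 \<le> a" and b: "0 \<le> b" and w: "0 \<le> w"
    using pos u z by (auto simp: a_def b_def w_def)
  have "w \<le> a * b"
  proof (cases "b = 0")
    case True
    show ?thesis
    proof (rule ccontr)
      assume "\<not> w \<le> a * b"
      hence "0 < w" using True by simp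
      moreover have "0 \<le> a * w" using a w by simp
      \<comment> \<open>With \<open>b = 0\<close> the expression in \<open>quad\<close> is linear in
        \<open>t\<close>; this \<open>t\<close> gives it the value \<open>- a - 2\<close>, which is
        negative.\<close>
      ultimately show False using quad[of "(a + 1) / w"] True by (simp add: field_simps)
    qed
  next
    case False
    hence "0 < b" using b by simp
    \<comment> \<open>The value \<open>t = 1 / b\<close> minimizes the quadratic and leaves
      \<open>0 \<le> a - w / b\<close>.\<close>
    thus ?thesis using quad[of "1 / b"] by (simp add: field_simps power2_eq_square)
  qed
  thus ?thesis unfolding w_def a_def b_def .
qed

lemma cscalar_prod_Cauchy_Schwarz:
  fixes u z :: "complex vec"
  assumes "u \<in> carrier_vec n" "z \<in> carrier_vec n"
  shows "(cmod (u \<bullet>c z))\<^sup>2 \<le> Re (u \<bullet>c u) * Re (z \<bullet>c z)"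
  by (rule semidefinite_form_Cauchy_Schwarz[where n = n and h = "\<lambda>u z. u \<bullet>c z"])
    (use assms in \<open>auto simp: add_scalar_prod_distrib[where n = n] Re_cscalar_prod_self_nonneg
      intro: cscalar_prod_commute\<close>)

section \<open>Homogeneity: from unit vectors to all vectors\<close>

lemma cscalar_prod_smult_both:
  fixes u v :: "complex vec"
  assumes "u \<in> carrier_vec n" "v \<in> carrier_vec n"
  shows "(k \<cdot>\<^sub>v u) \<bullet>c (k \<cdot>\<^sub>v v) = (cmod k)\<^sup>2 * (u \<bullet>c v)"
proof -
  have "(k \<cdot>\<^sub>v u) \<bullet>c (k \<cdot>\<^sub>v v) = (k * cnj k) * (u \<bullet>c v)"
    using assms by (simp add: conjugate_smult_vec mult_ac)
  thus ?thesis by (simp only: complex_norm_square)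
qed

lemma unit_vector_normalize:
  assumes v: "v \<in> carrier_vec n" "v \<noteq> 0\<^sub>v n"
  defines "r \<equiv> Re (v \<bullet>c v)"
  shows "complex_of_real (1 / sqrt r) \<cdot>\<^sub>v v \<in> unit_vectors n"
proof -
  have r: "0 < r" unfolding r_def by (rule Re_cscalar_prod_self_pos[OF v])
  have "Re ((complex_of_real (1 / sqrt r) \<cdot>\<^sub>v v) \<bullet>c (complex_of_real (1 / sqrt r) \<cdot>\<^sub>v v)) = 1"
    using r unfolding cscalar_prod_smult_both[OF v(1) v(1)]
    by (simp add: norm_divide power_divide flip: r_def)
  thus ?thesis using v unfolding unit_vectors_def by simp
qed

text \<open>Numerical range and radius see unit vectors only. Since the form scales by the squared
  modulus of the factor, their bounds extend to every vector with a factor ||v||^2.\<close>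

lemma quadratic_form_normalize:
  assumes A: "A \<in> carrier_mat n n" and v: "v \<in> carrier_vec n" "v \<noteq> 0\<^sub>v n"
  defines "r \<equiv> Re (v \<bullet>c v)"
  shows "\<exists>x\<in>unit_vectors n. (A *\<^sub>v v) \<bullet>c v = of_real r * ((A *\<^sub>v x) \<bullet>c x)"
proof
  define k where "k = complex_of_real (1 / sqrt r)"
  have r: "0 < r" unfolding r_def by (rule Re_cscalar_prod_self_pos[OF v])
  have k: "(cmod k)\<^sup>2 = 1 / r" using r by (simp add: k_def norm_divide power_divide)
  show "k \<cdot>\<^sub>v v \<in> unit_vectors n"
    unfolding k_def r_def by (rule unit_vector_normalize[OF v])
  have "(A *\<^sub>v (k \<cdot>\<^sub>v v)) \<bullet>c (k \<cdot>\<^sub>v v) = (cmod k)\<^sup>2 * ((A *\<^sub>v v) \<bullet>c v)"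
    unfolding mult_mat_vec[OF A v(1)]
    by (rule cscalar_prod_smult_both[OF mult_mat_vec_carrier[OF A v(1)] v(1)])
  thus "(A *\<^sub>v v) \<bullet>c v = of_real r * ((A *\<^sub>v (k \<cdot>\<^sub>v v)) \<bullet>c (k \<cdot>\<^sub>v v))"
    using r unfolding k by simp
qed

lemma sectorial_form:
  assumes A: "A \<in> carrier_mat n n" and s: "sectorial \<alpha> A" and v: "v \<in> carrier_vec n"
  shows "\<bar>Im ((A *\<^sub>v v) \<bullet>c v)\<bar> \<le> tan \<alpha> * Re ((A *\<^sub>v v) \<bullet>c v)"
proof (cases "v = 0\<^sub>v n")
  case True
  thus ?thesis using A v by simp
next
  case False
  define r where "r = Re (v \<bullet>c v)"
  have r: "0 < r" unfolding r_def by (rule Re_cscalar_prod_self_pos[OF v False])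
  obtain x where x: "x \<in> unit_vectors n" "(A *\<^sub>v v) \<bullet>c v = of_real r * ((A *\<^sub>v x) \<bullet>c x)"
    using quadratic_form_normalize[OF A v False] unfolding r_def by blast
  have "(A *\<^sub>v x) \<bullet>c x \<in> numerical_range A"
    using A x unfolding numerical_range_def by auto
  hence "\<bar>Im ((A *\<^sub>v x) \<bullet>c x)\<bar> \<le> tan \<alpha> * Re ((A *\<^sub>v x) \<bullet>c x)"
    using s unfolding sectorial_def sector_def by blast
  thus ?thesis using r unfolding x(2) by (simp add: abs_mult mult.left_commute)
qed

lemma quadratic_form_le_numerical_radius:
  assumes A: "A \<in> carrier_mat n n" and v: "v \<in> carrier_vec n"
  shows "cmod ((A *\<^sub>v v) \<bullet>c v) \<le> numerical_radius A * Re (v \<bullet>c v)"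
proof (cases "v = 0\<^sub>v n")
  case True
  thus ?thesis using A v by simp
next
  case False
  define r where "r = Re (v \<bullet>c v)"
  have r: "0 < r" unfolding r_def by (rule Re_cscalar_prod_self_pos[OF v False])
  obtain x where x: "x \<in> unit_vectors n" "(A *\<^sub>v v) \<bullet>c v = of_real r * ((A *\<^sub>v x) \<bullet>c x)"
    using quadratic_form_normalize[OF A v False] unfolding r_def by blast
  show ?thesis
    using r numerical_radius_upper[OF A x(1)]
    unfolding x(2) r_def[symmetric] by (simp add: norm_mult)
qed

section \<open>Real parts, accretivity and Cauchy-Schwarz for sectorial forms\<close>

lemma mat_adjoint_index:
  fixes A :: "complex mat"
  assumes "A \<in> carrier_mat n m" "i < m" "j < n"
  shows "mat_adjoint A $$ (i, j) = cnj (A $$ (j, i))"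
  using assms unfolding mat_adjoint_def by (simp add: mat_of_rows_def)

lemma quadratic_form_sum:
  assumes "A \<in> carrier_mat n n" "v \<in> carrier_vec n"
  shows "(A *\<^sub>v v) \<bullet>c v = (\<Sum>i<n. \<Sum>j<n. A $$ (i, j) * v $ j * cnj (v $ i))"
  using assms by (auto simp: scalar_prod_def lessThan_atLeast0 sum_distrib_right intro!: sum.cong)

text \<open>The quadratic form of the adjoint is the conjugate of that of \<open>A\<close>, so
  averaging the two leaves the real part. This turns \<open>accretive\<close> into a statement about
  the form of \<open>A\<close> itself.\<close>

lemma Re_quadratic_form_real_part_mat:
  assumes A: "A \<in> carrier_mat n n" and v: "v \<in> carrier_vec n"
  shows "Re ((real_part_mat A *\<^sub>v v) \<bullet>c v) = Re ((A *\<^sub>v v) \<bullet>c v)"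
proof -
  have adj: "dim_row (mat_adjoint A) = n" "dim_col (mat_adjoint A) = n"
    using mat_adjoint_carrier[OF A] by auto
  have R: "real_part_mat A \<in> carrier_mat n n" using A unfolding real_part_mat_def by simp
  have "(real_part_mat A *\<^sub>v v) \<bullet>c v =
      (\<Sum>i<n. \<Sum>j<n. (A $$ (i, j) + cnj (A $$ (j, i))) / 2 * v $ j * cnj (v $ i))"
    unfolding quadratic_form_sum[OF R v] using A adj
    by (auto simp: real_part_mat_def mat_adjoint_index intro!: sum.cong)
  also have "\<dots> = ((\<Sum>i<n. \<Sum>j<n. A $$ (i, j) * v $ j * cnj (v $ i))
      + (\<Sum>i<n. \<Sum>j<n. cnj (A $$ (j, i)) * v $ j * cnj (v $ i))) / 2"
    by (simp add: sum.distrib sum_divide_distrib add_divide_distrib distrib_right)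
  also have "(\<Sum>i<n. \<Sum>j<n. cnj (A $$ (j, i)) * v $ j * cnj (v $ i))
      = cnj (\<Sum>i<n. \<Sum>j<n. A $$ (i, j) * v $ j * cnj (v $ i))"
    by (subst sum.swap) (simp add: mult_ac)
  finally have eq: "(real_part_mat A *\<^sub>v v) \<bullet>c v
      = ((A *\<^sub>v v) \<bullet>c v + cnj ((A *\<^sub>v v) \<bullet>c v)) / 2"
    unfolding quadratic_form_sum[OF A v, symmetric] .
  show ?thesis unfolding eq by simp
qed

lemma accretive_form_pos:
  assumes A: "A \<in> carrier_mat n n" and "accretive A" and v: "v \<in> carrier_vec n" "v \<noteq> 0\<^sub>v n"
  shows "0 < Re ((A *\<^sub>v v) \<bullet>c v)"
proof -
  have "dim_row (real_part_mat A) = n"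
    using carrier_matD(1)[OF mat_adjoint_carrier[OF A]] unfolding real_part_mat_def by simp
  thus ?thesis
    using assms unfolding accretive_def pos_definite_def
    by (metis Re_quadratic_form_real_part_mat)
qed

text \<open>
  With $A = R + iS$, the sector condition makes $P = \tau R + S$ and $Q = \tau R - S$ positive
  semidefinite, and $2\tau A = (1 + i\tau) P + (1 - i\tau) Q$.
\<close>

lemma sectorial_Cauchy_Schwarz:
  assumes A: "A \<in> carrier_mat n n" and \<tau>: "0 < \<tau>"
    and sec: "\<And>v. v \<in> carrier_vec n \<Longrightarrow> \<bar>Im ((A *\<^sub>v v) \<bullet>c v)\<bar> \<le> \<tau> * Re ((A *\<^sub>v v) \<bullet>c v)"
    and u: "u \<in> carrier_vec n" and z: "z \<in> carrier_vec n"
  shows "(cmod ((A *\<^sub>v u) \<bullet>c z))\<^sup>2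
    \<le> (1 + \<tau>\<^sup>2) * (Re ((A *\<^sub>v u) \<bullet>c u) * Re ((A *\<^sub>v z) \<bullet>c z))"
proof -
  define g where "g u z = (A *\<^sub>v u) \<bullet>c z" for u z
  define h where "h c u z = c * g u z + cnj c * cnj (g z u)" for c u z
  \<comment> \<open>\<open>h c\<close> is the Hermitian form of cA + (cA)^*. This \<open>c\<close>
    makes it the form of P, and \<open>cnj c\<close> makes it the form of Q.\<close>
  define c where "c = (of_real \<tau> - \<i>) / 2"
  have g_sesquilinear: "g (u + v) w = g u w + g v w" "g w (u + v) = g w u + g w v"
      "g (k \<cdot>\<^sub>v u) w = k * g u w" "g w (k \<cdot>\<^sub>v u) = cnj k * g w u"
    if "u \<in> carrier_vec n" "v \<in> carrier_vec n" "w \<in> carrier_vec n" for u v w k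
    using that A unfolding g_def
    by (simp_all add: mult_add_distrib_mat_vec[OF A] mult_mat_vec[OF A] conjugate_smult_vec
        conjugate_add_vec[where n = n] add_scalar_prod_distrib[where n = n]
        scalar_prod_add_distrib[where n = n])
  have CS: "(cmod (h d u z))\<^sup>2 \<le> Re (h d u u) * Re (h d z z)"
    if pos: "\<And>v. v \<in> carrier_vec n \<Longrightarrow> 0 \<le> Re (h d v v)" for d
    by (rule semidefinite_form_Cauchy_Schwarz[OF _ _ _ pos u z])
      (simp_all add: h_def g_sesquilinear algebra_simps)
  have hc: "Re (h c v v) = \<tau> * Re (g v v) + Im (g v v)"
       "Re (h (cnj c) v v) = \<tau> * Re (g v v) - Im (g v v)" for v
    unfolding h_def c_def by (simp_all add: field_simps)
  have pos: "0 \<le> Re (h c v v)" "0 \<le> Re (h (cnj c) v v)" if "v \<in> carrier_vec n" for v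
    using sec[OF that] unfolding hc g_def by linarith+
  define p q where "p v = Re (h c v v)" and "q v = Re (h (cnj c) v v)" for v
  have p: "cmod (h c u z) \<le> sqrt (p u) * sqrt (p z)"
    using CS[of c] pos by (simp add: p_def real_le_rsqrt flip: real_sqrt_mult)
  have q: "cmod (h (cnj c) u z) \<le> sqrt (q u) * sqrt (q z)"
    using CS[of "cnj c"] pos by (simp add: q_def real_le_rsqrt flip: real_sqrt_mult)
  have nn: "0 \<le> p u" "0 \<le> p z" "0 \<le> q u" "0 \<le> q z"
    using pos u z by (auto simp: p_def q_def)
  have "2 * of_real \<tau> * g u z = (1 + \<i> * of_real \<tau>) * h c u z + (1 - \<i> * of_real \<tau>) * h (cnj c) u z"
    unfolding h_def c_def by (simp add: complex_eq_iff field_simps)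
  hence "cmod (2 * of_real \<tau> * g u z) \<le> cmod (1 + \<i> * of_real \<tau>) * cmod (h c u z)
      + cmod (1 - \<i> * of_real \<tau>) * cmod (h (cnj c) u z)"
    by (metis norm_mult norm_triangle_ineq)
  moreover have mod: "cmod (1 + \<i> * of_real \<tau>) = sqrt (1 + \<tau>\<^sup>2)"
      "cmod (1 - \<i> * of_real \<tau>) = sqrt (1 + \<tau>\<^sup>2)"
    by (simp_all add: cmod_def)
  ultimately have "2 * \<tau> * cmod (g u z) \<le> sqrt (1 + \<tau>\<^sup>2) * (cmod (h c u z) + cmod (h (cnj c) u z))"
    using \<tau> mod by (simp add: norm_mult algebra_simps)
  also have "\<dots> \<le> sqrt (1 + \<tau>\<^sup>2) * (sqrt (p u) * sqrt (p z) + sqrt (q u) * sqrt (q z))"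
    using p q by (intro mult_left_mono add_mono) auto
  finally have "(2 * \<tau> * cmod (g u z))\<^sup>2
      \<le> (sqrt (1 + \<tau>\<^sup>2) * (sqrt (p u) * sqrt (p z) + sqrt (q u) * sqrt (q z)))\<^sup>2"
    using \<tau> by (intro power_mono) auto
  also have "\<dots> = (1 + \<tau>\<^sup>2) * (sqrt (p u) * sqrt (p z) + sqrt (q u) * sqrt (q z))\<^sup>2"
    by (simp add: power_mult_distrib)
  also have "\<dots> \<le> (1 + \<tau>\<^sup>2) * ((p u + q u) * (p z + q z))"
  proof (intro mult_left_mono)
    \<comment> \<open>Lagrange's identity, giving Cauchy-Schwarz in the plane for the vectors of
      square roots of \<open>p\<close> and \<open>q\<close>.\<close>
    have "(p u + q u) * (p z + q z) - (sqrt (p u) * sqrt (p z) + sqrt (q u) * sqrt (q z))\<^sup>2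
        = (sqrt (p u) * sqrt (q z) - sqrt (q u) * sqrt (p z))\<^sup>2"
      using nn by (simp add: power2_sum power2_diff power_mult_distrib algebra_simps)
    thus "(sqrt (p u) * sqrt (p z) + sqrt (q u) * sqrt (q z))\<^sup>2 \<le> (p u + q u) * (p z + q z)"
      by (smt (verit) zero_le_power2)
  qed simp
  \<comment> \<open>The imaginary parts cancel in \<open>p v + q v\<close>, which equals
    \<open>2 * \<tau> * Re (g v v)\<close>. The factor \<open>(2 * \<tau>)\<^sup>2\<close> then
    cancels against the left-hand side because \<open>\<tau>\<close> is positive.\<close>
  also have "\<dots> = (2 * \<tau>)\<^sup>2 * ((1 + \<tau>\<^sup>2) * (Re (g u u) * Re (g z z)))"
    unfolding p_def q_def hc by (simp add: power2_eq_square algebra_simps)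
  finally show ?thesis
    using \<tau> unfolding g_def by (simp add: power_mult_distrib)
qed

text \<open>Inverse-free form of the lower bound on Re <A^{-1} y, y>, with y = A u. The sectorial
  inequality for the pair u, y bounds ||y||^4 by sec^2 \<alpha> Re <Au, u> Re <Ay, y>; the last
  factor is at most w(A) ||y||^2, and one ||y||^2 cancels.\<close>

lemma inverse_real_part_bound:
  assumes A: "A \<in> carrier_mat n n" and \<alpha>: "0 \<le> \<alpha>" "\<alpha> < pi / 2"
    and acc: "accretive A" and s: "sectorial \<alpha> A" and u: "u \<in> carrier_vec n"
  shows "(cos \<alpha>)\<^sup>2 * Re ((A *\<^sub>v u) \<bullet>c (A *\<^sub>v u)) \<le> numerical_radius A * Re ((A *\<^sub>v u) \<bullet>c u)"
proof -
  define y where "y = A *\<^sub>v u"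
  define r p b where "r = Re (y \<bullet>c y)" and "p = Re ((A *\<^sub>v u) \<bullet>c u)" and "b = Re ((A *\<^sub>v y) \<bullet>c y)"
  have y: "y \<in> carrier_vec n" using A u by (simp add: y_def)
  have c: "0 < cos \<alpha>" using \<alpha> by (intro cos_gt_zero_pi) auto
  have t: "0 \<le> tan \<alpha>" using \<alpha> tan_gt_zero[of \<alpha>] by (cases "\<alpha> = 0") auto
  have sec: "1 + (tan \<alpha>)\<^sup>2 = 1 / (cos \<alpha>)\<^sup>2"
    using tan_sec[of \<alpha>] c by (simp add: inverse_eq_divide power_divide)
  have nn: "0 \<le> Re ((A *\<^sub>v v) \<bullet>c v)" if "v \<in> carrier_vec n" for v
    using accretive_form_pos[OF A acc that] that A by (cases "v = 0\<^sub>v n") auto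
  have r: "0 \<le> r" unfolding r_def by (rule Re_cscalar_prod_self_nonneg)
  have "r\<^sup>2 \<le> (cmod (y \<bullet>c y))\<^sup>2"
    using r abs_Re_le_cmod[of "y \<bullet>c y"] unfolding r_def by (intro power_mono) auto
  \<comment> \<open>\<open>tan \<alpha>\<close> may be zero, so it is approached from the right.\<close>
  moreover have "(cmod (y \<bullet>c y))\<^sup>2 \<le> (1 + \<tau>\<^sup>2) * (p * b)" if "tan \<alpha> < \<tau>" for \<tau>
    unfolding p_def b_def y_def[symmetric]
  proof (rule sectorial_Cauchy_Schwarz[OF A _ _ u y, folded y_def])
    show "0 < \<tau>" using that t by simp
    fix v :: "complex vec"
    assume v: "v \<in> carrier_vec n"
    have "tan \<alpha> * Re ((A *\<^sub>v v) \<bullet>c v) \<le> \<tau> * Re ((A *\<^sub>v v) \<bullet>c v)"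
      using nn[OF v] that by (intro mult_right_mono) auto
    thus "\<bar>Im ((A *\<^sub>v v) \<bullet>c v)\<bar> \<le> \<tau> * Re ((A *\<^sub>v v) \<bullet>c v)"
      using sectorial_form[OF A s v] by linarith
  qed
  ultimately have "\<forall>\<^sub>F \<tau> in at_right (tan \<alpha>). r\<^sup>2 \<le> (1 + \<tau>\<^sup>2) * (p * b)"
    by (intro eventually_mono[OF eventually_at_right_less]) force
  moreover have "((\<lambda>\<tau>. (1 + \<tau>\<^sup>2) * (p * b)) \<longlongrightarrow> (1 + (tan \<alpha>)\<^sup>2) * (p * b)) (at_right (tan \<alpha>))"
    by (intro tendsto_intros)
  ultimately have "r\<^sup>2 \<le> (1 + (tan \<alpha>)\<^sup>2) * (p * b)"
    by (intro tendsto_lowerbound[where F = "at_right (tan \<alpha>)"]) auto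
  hence "(cos \<alpha>)\<^sup>2 * r\<^sup>2 \<le> p * b" using c unfolding sec by (simp add: field_simps)
  also have "b \<le> numerical_radius A * r"
    using quadratic_form_le_numerical_radius[OF A y] complex_Re_le_cmod[of "(A *\<^sub>v y) \<bullet>c y"]
    unfolding b_def r_def by linarith
  hence "p * b \<le> p * (numerical_radius A * r)"
    using nn[OF u] unfolding p_def by (rule mult_left_mono)
  finally have "r * ((cos \<alpha>)\<^sup>2 * r) \<le> r * (numerical_radius A * p)"
    by (simp add: power2_eq_square mult_ac)
  hence "(cos \<alpha>)\<^sup>2 * r \<le> numerical_radius A * p" if "r \<noteq> 0"
    using r that by (simp add: mult_le_cancel_left)
  \<comment> \<open>Here nothing can be cancelled, but \<open>y = 0\<close> makes \<open>p\<close>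
    vanish too.\<close>
  moreover have "0 \<le> numerical_radius A * p" if "r = 0"
  proof -
    have "y = 0\<^sub>v n"
      using that Re_cscalar_prod_self_pos[OF y] unfolding r_def by auto
    thus ?thesis using u by (simp add: p_def flip: y_def)
  qed
  ultimately show ?thesis
    unfolding r_def p_def y_def by (cases "r = 0") (auto simp: r_def y_def p_def)
qed

section \<open>Matrix inverses and their continuity in a parameter\<close>

text \<open>\<open>mat_inv\<close> takes \<open>the\<close> of an option, so it is meaningful only
  once \<open>mat_inverse\<close> is known to succeed; a nonzero determinant guarantees
  that.\<close>

lemma mat_inv_inverse:
  assumes A: "A \<in> carrier_mat n n" and d: "det A \<noteq> 0"
  shows "mat_inv A \<in> carrier_mat n n" "A * mat_inv A = 1\<^sub>m n" "mat_inv A * A = 1\<^sub>m n"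
proof -
  have "A \<in> Units (ring_mat TYPE(complex) n ())" by (rule det_non_zero_imp_unit[OF A d])
  then obtain B where "mat_inverse A = Some B"
    using mat_inverse(1)[OF A, where b = "()"] by (cases "mat_inverse A") auto
  thus "mat_inv A \<in> carrier_mat n n" "A * mat_inv A = 1\<^sub>m n" "mat_inv A * A = 1\<^sub>m n"
    using mat_inverse(2)[OF A] unfolding mat_inv_def by auto
qed

lemma mult_mat_vec_mat_inv:
  assumes A: "A \<in> carrier_mat n n" and d: "det A \<noteq> 0" and v: "v \<in> carrier_vec n"
  shows "A *\<^sub>v (mat_inv A *\<^sub>v v) = v"
  using mat_inv_inverse[OF A d] v
  by (simp add: assoc_mult_mat_vec[symmetric, OF A _ v])

text \<open>Cramer's rule, obtained by multiplying the adjugate with \<open>A * mat_inv A\<close>.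
  It exhibits the entries of the inverse as quotients of polynomials in the entries of
  \<open>A\<close>, whence their continuity.\<close>

lemma mat_inv_index:
  assumes A: "A \<in> carrier_mat n n" and d: "det A \<noteq> 0" and ij: "i < n" "j < n"
  shows "mat_inv A $$ (i, j) = cofactor A j i / det A"
proof -
  note inv = mat_inv_inverse[OF A d] and adj = adj_mat[OF A]
  have "adj_mat A = adj_mat A * (A * mat_inv A)"
    using right_mult_one_mat[OF adj(1)] inv by simp
  also have "\<dots> = (adj_mat A * A) * mat_inv A"
    using adj(1) A inv(1) by (rule assoc_mult_mat[symmetric])
  also have "\<dots> = det A \<cdot>\<^sub>m mat_inv A"
    using inv(1) unfolding adj(3) by (simp add: mult_smult_assoc_mat[OF one_carrier_mat inv(1)])
  finally have "adj_mat A $$ (i, j) = det A * mat_inv A $$ (i, j)" using inv(1) ij by simp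
  thus ?thesis using d A ij unfolding adj_mat_def by simp
qed

text \<open>By the Leibniz formula the determinant is a finite sum of products of entries;
  permutations keep the indices below \<open>n\<close>.\<close>

lemma continuous_on_det:
  fixes M :: "'a :: topological_space \<Rightarrow> complex mat"
  assumes M: "\<And>s. M s \<in> carrier_mat n n"
    and cont: "\<And>i j. \<lbrakk>i < n; j < n\<rbrakk> \<Longrightarrow> continuous_on T (\<lambda>s. M s $$ (i, j))"
  shows "continuous_on T (\<lambda>s. det (M s))"
  unfolding det_def'[OF M]
  by (intro continuous_intros cont) (auto simp: permutes_in_image[where S = "{0..<n}", simplified])

lemma continuous_on_mat_inv_index:
  fixes M :: "'a :: topological_space \<Rightarrow> complex mat"
  assumes M: "\<And>s. M s \<in> carrier_mat n n"
    and cont: "\<And>i j. \<lbrakk>i < n; j < n\<rbrakk> \<Longrightarrow> continuous_on T (\<lambda>s. M s $$ (i, j))"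
    and d: "\<And>s. s \<in> T \<Longrightarrow> det (M s) \<noteq> 0"
    and ij: "i < n" "j < n"
  shows "continuous_on T (\<lambda>s. mat_inv (M s) $$ (i, j))"
proof -
  have dims: "dim_row (M s) = n" "dim_col (M s) = n" for s using M[of s] by auto
  have "continuous_on T (\<lambda>s. det (mat_delete (M s) j i))"
  proof (rule continuous_on_det)
    show "mat_delete (M s) j i \<in> carrier_mat (n - 1) (n - 1)" for s
      by (rule mat_delete_carrier[OF M])
    fix k l
    assume kl: "k < n - 1" "l < n - 1"
    thus "continuous_on T (\<lambda>s. mat_delete (M s) j i $$ (k, l))"
      unfolding mat_delete_def by (auto simp: dims intro!: cont)
  qed
  hence "continuous_on T (\<lambda>s. cofactor (M s) j i / det (M s))"
    unfolding cofactor_def using d by (intro continuous_intros continuous_on_det[OF M cont]) auto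
  thus ?thesis
    by (rule continuous_on_eq) (use mat_inv_index[OF M d ij] in auto)
qed

section \<open>Inverses and numerical radii of accretive matrices\<close>

text \<open>The form of \<open>A\<close> would vanish at a nonzero kernel vector.\<close>

lemma accretive_det_nonzero:
  assumes A: "A \<in> carrier_mat n n" and acc: "accretive A"
  shows "det A \<noteq> 0"
proof
  assume "det A = 0"
  then obtain v where v: "v \<in> carrier_vec n" "v \<noteq> 0\<^sub>v n" "A *\<^sub>v v = 0\<^sub>v n"
    using det_0_iff_vec_prod_zero[OF A] by blast
  thus False using accretive_form_pos[OF A acc v(1,2)] by simp
qed

lemma accretive_numerical_radius_pos:
  assumes A: "A \<in> carrier_mat n n" and acc: "accretive A" and n: "0 < n"
  shows "0 < numerical_radius A"
proof -
  \<comment> \<open>Only the existence of a unit vector is taken from this.\<close>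
  obtain x where x: "x \<in> unit_vectors n" using numerical_radius_attained[OF A n] by blast
  hence xc: "x \<in> carrier_vec n" "x \<noteq> 0\<^sub>v n" unfolding unit_vectors_def by auto
  have "0 < Re ((A *\<^sub>v x) \<bullet>c x)" by (rule accretive_form_pos[OF A acc xc])
  also have "\<dots> \<le> numerical_radius A"
    using complex_Re_le_cmod numerical_radius_upper[OF A x] by (rule order_trans)
  finally show ?thesis .
qed

text \<open>The substitution u = A^{-1} y in \<open>inverse_real_part_bound\<close>; exchanging the
  arguments of the inner product does not change its real part.\<close>

lemma mat_inv_form_lower_bound:
  assumes A: "A \<in> carrier_mat n n" and n: "0 < n" and \<alpha>: "0 \<le> \<alpha>" "\<alpha> < pi / 2"
    and acc: "accretive A" and s: "sectorial \<alpha> A" and y: "y \<in> carrier_vec n"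
  shows "(cos \<alpha>)\<^sup>2 * inverse (numerical_radius A) * Re (y \<bullet>c y) \<le> Re ((mat_inv A *\<^sub>v y) \<bullet>c y)"
proof -
  define u where "u = mat_inv A *\<^sub>v y"
  note d = accretive_det_nonzero[OF A acc]
  have u: "u \<in> carrier_vec n" using mat_inv_inverse(1)[OF A d] y unfolding u_def by simp
  have Au: "A *\<^sub>v u = y" unfolding u_def by (rule mult_mat_vec_mat_inv[OF A d y])
  have "Re (u \<bullet>c y) = Re (y \<bullet>c u)"
    using cscalar_prod_commute[OF y u] by simp
  thus ?thesis
    using inverse_real_part_bound[OF A \<alpha> acc s u] accretive_numerical_radius_pos[OF A acc n]
    unfolding Au u_def[symmetric] by (simp add: field_simps)
qed

section \<open>The weighted harmonic mean of two sectorial matrices\<close>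

locale sectorial_pair =
  fixes \<alpha> :: real and n :: nat and A B :: "complex mat"
  assumes \<alpha>: "0 \<le> \<alpha>" "\<alpha> < pi / 2" and n: "0 < n"
    and A: "A \<in> carrier_mat n n" "accretive A" "sectorial \<alpha> A"
    and B: "B \<in> carrier_mat n n" "accretive B" "sectorial \<alpha> B"
begin

definition pencil :: "real \<Rightarrow> complex mat" where
  "pencil s = complex_of_real (1 - s) \<cdot>\<^sub>m mat_inv A + complex_of_real s \<cdot>\<^sub>m mat_inv B"

text \<open>The 1 x 1 analogue of \<open>pencil\<close> at the two numerical radii; its inverse is
  the integrand of \<open>scalar_mean\<close>.\<close>

definition radius_pencil :: "real \<Rightarrow> real" where
  "radius_pencil s = (1 - s) * inverse (numerical_radius A) + s * inverse (numerical_radius B)"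

lemma mat_inv_carrier: "mat_inv A \<in> carrier_mat n n" "mat_inv B \<in> carrier_mat n n"
  using mat_inv_inverse(1) accretive_det_nonzero A B by auto

lemma pencil_carrier: "pencil s \<in> carrier_mat n n"
  using mat_inv_carrier unfolding pencil_def by simp

lemma harmonic_mean_mat_pencil: "harmonic_mean_mat s A B = mat_inv (pencil s)"
  unfolding harmonic_mean_mat_def pencil_def ..

lemma cos_pos: "0 < cos \<alpha>"
  using \<alpha> by (intro cos_gt_zero_pi) auto

lemma radius_pencil_pos:
  assumes "s \<in> {0..1}"
  shows "0 < radius_pencil s"
proof -
  have "0 < inverse (numerical_radius A)" "0 < inverse (numerical_radius B)"
    using accretive_numerical_radius_pos n A B by auto
  \<comment> \<open>For \<open>s = 0\<close> the first summand is the positive one, for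
    \<open>s > 0\<close> the second.\<close>
  thus ?thesis using assms unfolding radius_pencil_def
    by (cases "s = 0") (auto intro!: add_nonneg_pos)
qed

text \<open>A convex combination of the bounds for the two inverses. This coercivity yields both the
  invertibility of the pencil and the size estimate for its inverse.\<close>

lemma pencil_form_lower_bound:
  assumes s: "s \<in> {0..1}" and y: "y \<in> carrier_vec n"
  shows "(cos \<alpha>)\<^sup>2 * radius_pencil s * Re (y \<bullet>c y) \<le> Re ((pencil s *\<^sub>v y) \<bullet>c y)"
proof -
  have "(cos \<alpha>)\<^sup>2 * radius_pencil s * Re (y \<bullet>c y)
      = (1 - s) * ((cos \<alpha>)\<^sup>2 * inverse (numerical_radius A) * Re (y \<bullet>c y))
        + s * ((cos \<alpha>)\<^sup>2 * inverse (numerical_radius B) * Re (y \<bullet>c y))"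
    unfolding radius_pencil_def by (simp add: algebra_simps)
  also have "\<dots> \<le> (1 - s) * Re ((mat_inv A *\<^sub>v y) \<bullet>c y) + s * Re ((mat_inv B *\<^sub>v y) \<bullet>c y)"
    using s mat_inv_form_lower_bound[OF A(1) n \<alpha> A(2,3) y]
      mat_inv_form_lower_bound[OF B(1) n \<alpha> B(2,3) y]
    by (intro add_mono mult_left_mono) auto
  also have "(pencil s *\<^sub>v y) \<bullet>c y
      = complex_of_real (1 - s) * ((mat_inv A *\<^sub>v y) \<bullet>c y) + complex_of_real s * ((mat_inv B *\<^sub>v y) \<bullet>c y)"
  proof -
    have smult: "(k \<cdot>\<^sub>m M) *\<^sub>v y = k \<cdot>\<^sub>v (M *\<^sub>v y)" if "M \<in> carrier_mat n n" for k and M :: "complex mat"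
      using that y by (intro eq_vecI) auto
    show ?thesis
      using mat_inv_carrier y unfolding pencil_def
      by (simp add: add_mult_distrib_mat_vec[where nr = n and nc = n] smult
          add_scalar_prod_distrib[where n = n] del: of_real_diff)
  qed
  hence "(1 - s) * Re ((mat_inv A *\<^sub>v y) \<bullet>c y) + s * Re ((mat_inv B *\<^sub>v y) \<bullet>c y)
      = Re ((pencil s *\<^sub>v y) \<bullet>c y)" by simp
  finally show ?thesis .
qed

lemma pencil_det_nonzero:
  assumes s: "s \<in> {0..1}"
  shows "det (pencil s) \<noteq> 0"
proof
  assume "det (pencil s) = 0"
  then obtain y where y: "y \<in> carrier_vec n" "y \<noteq> 0\<^sub>v n" "pencil s *\<^sub>v y = 0\<^sub>v n"
    using det_0_iff_vec_prod_zero[OF pencil_carrier] by blast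
  have "0 < (cos \<alpha>)\<^sup>2 * radius_pencil s * Re (y \<bullet>c y)"
    using cos_pos radius_pencil_pos[OF s] Re_cscalar_prod_self_pos[OF y(1,2)] by simp
  also have "\<dots> \<le> 0" using pencil_form_lower_bound[OF s y(1)] y by simp
  finally show False by simp
qed

text \<open>Since ||x|| = 1, Cauchy-Schwarz and coercivity give the chain k t^2 <= k ||y||^2 <= Re
  <x, y> <= t, hence t <= 1/k.\<close>

lemma harmonic_mean_form_bound:
  assumes s: "s \<in> {0..1}" and x: "x \<in> unit_vectors n"
  shows "cmod ((harmonic_mean_mat s A B *\<^sub>v x) \<bullet>c x) \<le> (1 / cos \<alpha>)\<^sup>2 * inverse (radius_pencil s)"
proof -
  define y where "y = harmonic_mean_mat s A B *\<^sub>v x"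
  define t r k where "t = cmod (y \<bullet>c x)" and "r = Re (y \<bullet>c y)" and "k = (cos \<alpha>)\<^sup>2 * radius_pencil s"
  note d = pencil_det_nonzero[OF s]
  have xc: "x \<in> carrier_vec n" and x1: "Re (x \<bullet>c x) = 1"
    using x unfolding unit_vectors_def by auto
  have y: "y \<in> carrier_vec n"
    using mat_inv_inverse(1)[OF pencil_carrier d] xc
    unfolding y_def harmonic_mean_mat_pencil by simp
  have Cy: "pencil s *\<^sub>v y = x"
    unfolding y_def harmonic_mean_mat_pencil by (rule mult_mat_vec_mat_inv[OF pencil_carrier d xc])
  have k: "0 < k" using cos_pos radius_pencil_pos[OF s] by (simp add: k_def)
  have t2: "t\<^sup>2 \<le> r"
    using cscalar_prod_Cauchy_Schwarz[OF y xc] x1 by (simp add: t_def r_def)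
  have "k * r \<le> Re (x \<bullet>c y)"
    using pencil_form_lower_bound[OF s y] unfolding Cy k_def r_def .
  also have "\<dots> \<le> t"
    using complex_Re_le_cmod[of "x \<bullet>c y"] cscalar_prod_commute[OF y xc] by (simp add: t_def)
  finally have "k * t\<^sup>2 \<le> t" using t2 k by (smt (verit) mult_left_mono)
  moreover have "0 \<le> t" by (simp add: t_def)
  ultimately have "k * t \<le> 1"
    by (cases "t = 0") (auto simp: power2_eq_square)
  hence "t \<le> 1 / k" using k by (simp add: field_simps)
  thus ?thesis unfolding t_def k_def y_def by (simp add: power_divide inverse_eq_divide)
qed

text \<open>Supplies the integrability of the entries that define
  \<open>operator_mean\<close>.\<close>

lemma continuous_on_harmonic_mean_index:
  assumes "i < n" "j < n"
  shows "continuous_on {0..1} (\<lambda>s. harmonic_mean_mat s A B $$ (i, j))"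
  unfolding harmonic_mean_mat_pencil
proof (rule continuous_on_mat_inv_index[OF pencil_carrier _ pencil_det_nonzero assms])
  fix i j
  assume "i < n" "j < n"
  hence "pencil s $$ (i, j) = complex_of_real (1 - s) * mat_inv A $$ (i, j)
      + complex_of_real s * mat_inv B $$ (i, j)" for s
    using mat_inv_carrier unfolding pencil_def by (simp del: of_real_diff)
  thus "continuous_on {0..1} (\<lambda>s. pencil s $$ (i, j))"
    by (simp only:) (intro continuous_intros)
qed

end

section \<open>Integration over the representing measure\<close>

text \<open>Compactness makes \<open>g\<close> bounded, which suffices on a probability space.
  Measurability is with respect to the Borel sets of [0,1], so values of \<open>g\<close> outside
  the interval do not matter.\<close>

lemma integrable_continuous_unit_interval:
  fixes g :: "real \<Rightarrow> 'a :: {banach, second_countable_topology}"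
  assumes "prob_space \<nu>" and sets: "sets \<nu> = sets (restrict_space borel {0..1})"
    and g: "continuous_on {0..1} g"
  shows "integrable \<nu> g"
proof -
  interpret prob_space \<nu> by fact
  have space: "space \<nu> = {0..1}" using sets_eq_imp_space_eq[OF sets] by (simp add: space_restrict_space)
  have "bounded (g ` {0..1})" by (intro compact_imp_bounded compact_continuous_image g compact_Icc)
  then obtain K where K: "\<forall>s\<in>{0..1}. norm (g s) \<le> K" unfolding bounded_iff by auto
  show ?thesis
  proof (rule integrable_const_bound)
    show "AE s in \<nu>. norm (g s) \<le> K" using K by (intro AE_I2) (simp add: space)
    show "g \<in> borel_measurable \<nu>"
      using borel_measurable_continuous_on_restrict[OF g] measurable_cong_sets[OF sets refl] by blast
  qed
qed

theorem theorem3p7: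
  fixes \<alpha> :: real and n :: nat and A B :: "complex mat"
    and f :: "real \<Rightarrow> real" and \<nu> :: "real measure"
  assumes "0 \<le> \<alpha>" and "\<alpha> < pi / 2"
    and "0 < n" and "A \<in> carrier_mat n n" and "B \<in> carrier_mat n n"
    and "accretive A" and "accretive B"
    and "sectorial \<alpha> A" and "sectorial \<alpha> B"
    and "\<And>x. 0 < x \<Longrightarrow> 0 < f x" and "operator_monotone f" and "f 1 = 1"
    and "representing_measure f \<nu>"
  shows "numerical_radius (operator_mean \<nu> A B)
           \<le> (1 / cos \<alpha>) ^ 3 * scalar_mean \<nu> (numerical_radius A) (numerical_radius B)"
proof -
  interpret sectorial_pair \<alpha> n A B using assms by unfold_locales
  let ?H = "\<lambda>s. harmonic_mean_mat s A B"
  have prob: "prob_space \<nu>" and sets: "sets \<nu> = sets (restrict_space borel {0..1})"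
    using assms(13) unfolding representing_measure_def by auto
  note int = integrable_continuous_unit_interval[OF prob sets]
  have space: "space \<nu> = {0..1}" using sets_eq_imp_space_eq[OF sets] by (simp add: space_restrict_space)
  have M: "operator_mean \<nu> A B \<in> carrier_mat n n" using A(1) unfolding operator_mean_def by auto
  \<comment> \<open>A maximizing \<open>x\<close> replaces the supremum by a single quadratic form,
    which can be moved under the integral.\<close>
  obtain x where x: "x \<in> unit_vectors n"
    "numerical_radius (operator_mean \<nu> A B) = cmod ((operator_mean \<nu> A B *\<^sub>v x) \<bullet>c x)"
    using numerical_radius_attained[OF M n] by blast
  have xc: "x \<in> carrier_vec n" using x unfolding unit_vectors_def by simp
  have form: "(?H s *\<^sub>v x) \<bullet>c x = (\<Sum>i<n. \<Sum>j<n. ?H s $$ (i, j) * x $ j * cnj (x $ i))"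
    if "s \<in> {0..1}" for s
    using mat_inv_inverse(1)[OF pencil_carrier pencil_det_nonzero[OF that]]
    by (intro quadratic_form_sum xc) (simp add: harmonic_mean_mat_pencil)
  have entry: "integrable \<nu> (\<lambda>s. ?H s $$ (i, j))" if "i < n" "j < n" for i j
    by (intro int continuous_on_harmonic_mean_index that)
  \<comment> \<open>For fixed \<open>x\<close> the form is a finite linear combination of matrix
    entries, so it commutes with the entrywise integral.\<close>
  have "(operator_mean \<nu> A B *\<^sub>v x) \<bullet>c x
      = (\<Sum>i<n. \<Sum>j<n. (LINT s|\<nu>. ?H s $$ (i, j)) * x $ j * cnj (x $ i))"
    unfolding quadratic_form_sum[OF M xc] using A(1) by (simp add: operator_mean_def)
  also have "\<dots> = (\<Sum>i<n. \<Sum>j<n. LINT s|\<nu>. ?H s $$ (i, j) * x $ j * cnj (x $ i))"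
    using entry by (intro sum.cong refl) simp
  also have "\<dots> = (\<Sum>i<n. LINT s|\<nu>. (\<Sum>j<n. ?H s $$ (i, j) * x $ j * cnj (x $ i)))"
    by (intro sum.cong refl Bochner_Integration.integral_sum[symmetric] integrable_mult_left entry) auto
  also have "\<dots> = (LINT s|\<nu>. (\<Sum>i<n. \<Sum>j<n. ?H s $$ (i, j) * x $ j * cnj (x $ i)))"
    by (intro Bochner_Integration.integral_sum[symmetric] Bochner_Integration.integrable_sum
        integrable_mult_left entry) auto
  also have "\<dots> = (LINT s|\<nu>. (?H s *\<^sub>v x) \<bullet>c x)"
    using form by (intro Bochner_Integration.integral_cong) (auto simp: space)
  finally have "numerical_radius (operator_mean \<nu> A B) = cmod (LINT s|\<nu>. (?H s *\<^sub>v x) \<bullet>c x)"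
    unfolding x(2) by simp
  also have "\<dots> \<le> (LINT s|\<nu>. (1 / cos \<alpha>)\<^sup>2 * inverse (radius_pencil s))"
  proof (rule order_trans[OF integral_norm_bound])
    \<comment> \<open>Continuity of both integrands gives the integrability that monotonicity of the
      integral requires.\<close>
    have "continuous_on {0..1} (\<lambda>s. \<Sum>i<n. \<Sum>j<n. ?H s $$ (i, j) * x $ j * cnj (x $ i))"
      by (intro continuous_intros continuous_on_harmonic_mean_index) auto
    hence "continuous_on {0..1} (\<lambda>s. (?H s *\<^sub>v x) \<bullet>c x)"
      by (rule continuous_on_eq) (simp add: form)
    moreover have "continuous_on {0..1} (\<lambda>s. (1 / cos \<alpha>)\<^sup>2 * inverse (radius_pencil s))"
      using radius_pencil_pos unfolding radius_pencil_def
      by (intro continuous_intros) force+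
    ultimately show "(LINT s|\<nu>. cmod ((?H s *\<^sub>v x) \<bullet>c x))
        \<le> (LINT s|\<nu>. (1 / cos \<alpha>)\<^sup>2 * inverse (radius_pencil s))"
      using harmonic_mean_form_bound x(1) by (intro integral_mono int continuous_on_norm) (auto simp: space)
  qed
  also have "\<dots> = (1 / cos \<alpha>)\<^sup>2 * scalar_mean \<nu> (numerical_radius A) (numerical_radius B)"
    unfolding scalar_mean_def radius_pencil_def by simp
  \<comment> \<open>Passing to the cube uses sec \<alpha> >= 1 and the nonnegativity of the scalar
    mean.\<close>
  also have "\<dots> \<le> (1 / cos \<alpha>) ^ 3 * scalar_mean \<nu> (numerical_radius A) (numerical_radius B)"
  proof (rule mult_right_mono)
    show "(1 / cos \<alpha>)\<^sup>2 \<le> (1 / cos \<alpha>) ^ 3"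
      using cos_pos by (intro power_increasing) auto
    show "0 \<le> scalar_mean \<nu> (numerical_radius A) (numerical_radius B)"
      using radius_pencil_pos unfolding scalar_mean_def radius_pencil_def
      by (intro Bochner_Integration.integral_nonneg) (force simp: space intro: less_imp_le)
  qed
  finally show ?thesis .
qed

end
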